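(* Let $\{x^k\}$ and $\{d^k\}$ be the sequences generated by the RNBPG method (described in the context). Assume that $F$ is uniformly continuous in $\Omega(x^0)=\{x\in\mathbb{R}^N : F(x)\le F(x^0)\}$. Then the following statements hold: (i) $\lim_{k\to\infty}\|d^k\|=0$ and $\lim_{k\to\infty}F(x^k)=F^*_{\xi_\infty}$ for some $F^*_{\xi_\infty}\in\mathbb{R}$ (depending on the realization $\xi_\infty=\{i_0,i_1,i_2,\dots\}$ of the sequence of random block indices). (ii) $\lim_{k\to\infty}\mathbf{E}_{\xi_k}[\|d^k\|]=0$ and $$\lim_{k\to\infty}\mathbf{E}_{\xi_{k-1}}[F(x^k)]=\lim_{k\to\infty}\mathbf{E}_{\xi_{k-1}}[F(x^{\ell(k)})]=\mathbf{E}_{\xi_\infty}[F^*_{\xi_\infty}].$$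
   Context: **Problem.** $x\in\mathbb{R}^N$ is partitioned into blocks $x=(x_1,\dots,x_n)$, $x_i\in\mathbb{R}^{N_i}$. Consider $\min_{x\in\mathbb{R}^N}\{F(x):=f(x)+\Psi(x)\}$ with $\Psi(x)=\sum_{i=1}^n\Psi_i(x_i)$. The function $f:\mathbb{R}^N\to\mathbb{R}$ is differentiable (possibly nonconvex), each $\Psi_i:\mathbb{R}^{N_i}\to\mathbb{R}\cup\{+\infty\}$ is possibly nonconvex and nonsmooth. $\|\cdot\|$ is the Euclidean norm, $\nabla_i f$ is the partial gradient with respect to $x_i$, and there are constants $L_i>0$ with $\|\nabla_i f(x+h)-\nabla_i f(x)\|\le L_i\|h\|$ for all $x\in\mathbb{R}^N$, all $i$, and all $h\in\mathcal{S}_i=\{h=(h_1,\dots,h_n): h_j=0\ \forall j\ne i\}$. The set of optimal solutions is nonempty; $\mathrm{dom}(F)=\{x:F(x)<+\infty\}$. **RNBPG method.** Choose $x^0\in\mathrm{dom}(F)$, $\eta>1$, $\sigma>0$, $0<\underline\theta\le\bar\theta$, an integer $M\ge 0$, and $0<p_i<1$ with $\sum_{i=1}^n p_i=1$. For $k=0,1,2,\dots$: 1) Set $d^k=0$. Pick $i_k=i\in\{1,\dots,n\}$ with probability $p_i$. Choose $\theta_k^0\in[\underline\theta,\bar\theta]$. 2) For $j=0,1,\dots$: let $\theta_k=\theta_k^0\eta^j$, compute the $i_k$-th block of $d^k$ (the other blocks being $0$) as $(d^k)_{i_k}=\arg\min_s\{\nabla_{i_k}f(x^k)^Ts+\frac{\theta_k}{2}\|s\|^2+\Psi_{i_k}(x^k_{i_k}+s)\}$;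 if $F(x^k+d^k)\le\max_{[k-M]^+\le i\le k}F(x^i)-\frac{\sigma}{2}\|d^k\|^2$, stop the inner loop. 3) Set $x^{k+1}=x^k+d^k$. Here $[t]^+=\max\{0,t\}$, and $\arg\min$ denotes a minimizer (assumed to exist). **Randomness.** The $i_k$ are drawn independently; $\xi_k=\{i_0,\dots,i_k\}$, and $\mathbf{E}_{\xi_k}$ is expectation with respect to $\xi_k$ ($\mathbf{E}_{\xi_{-1}}[F(x^0)]=F(x^0)$). All other choices (such as $\theta^0_k$ and the minimizers) are determined by the realized indices, so $x^k$ is a function of $\xi_{k-1}$ and $d^k$ is a function of $\xi_k$. **Notation.** $\ell(k)=\arg\max_i\{F(x^i): i=[k-M]^+,\dots,k\}$ for $k\ge0$. *)

theory Defs
  imports "HOL-Probability.Probability"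
begin

text \<open>
  A partition of the N coordinates into n blocks is a map \<open>blk\<close> sending each coordinate to
  the index of its block.  The dimensions of the blocks differ, so the space of block \<open>i\<close> is not
  a type of its own: it is identified with the subspace of vectors vanishing outside block \<open>i\<close>,
  and the block components of vectors and of the gradient are taken in that subspace (which
  preserves norms and inner products).
\<close>

definition block_space :: "('N::finite \<Rightarrow> 'n) \<Rightarrow> 'n \<Rightarrow> (real ^ 'N) set" where
  "block_space blk i = {h. \<forall>c. blk c \<noteq> i \<longrightarrow> h $ c = 0}"

definition block :: "('N::finite \<Rightarrow> 'n) \<Rightarrow> 'n \<Rightarrow> real ^ 'N \<Rightarrow> real ^ 'N" where
  "block blk i x = (\<chi> c. if blk c = i then x $ c else 0)"

definition gradient :: "(real ^ 'N::finite \<Rightarrow> real) \<Rightarrow> real ^ 'N \<Rightarrow> real ^ 'N" where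
  "gradient f x = (THE g. GDERIV f x :> g)"

definition partial_gradient ::
  "('N::finite \<Rightarrow> 'n) \<Rightarrow> 'n \<Rightarrow> (real ^ 'N \<Rightarrow> real) \<Rightarrow> real ^ 'N \<Rightarrow> real ^ 'N" where
  "partial_gradient blk i f x = block blk i (gradient f x)"

text \<open>Only the values of \<open>\<Psi> i\<close> on \<open>block_space blk i\<close> ever matter.\<close>

definition objective ::
  "('N::finite \<Rightarrow> 'n::finite) \<Rightarrow> (real ^ 'N \<Rightarrow> real) \<Rightarrow> ('n \<Rightarrow> real ^ 'N \<Rightarrow> ereal) \<Rightarrow> real ^ 'N \<Rightarrow> ereal"
  where "objective blk f \<Psi> x = ereal (f x) + (\<Sum>i\<in>UNIV. \<Psi> i (block blk i x))"

definition prox_model ::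
  "('N::finite \<Rightarrow> 'n) \<Rightarrow> (real ^ 'N \<Rightarrow> real) \<Rightarrow> ('n \<Rightarrow> real ^ 'N \<Rightarrow> ereal) \<Rightarrow>
   'n \<Rightarrow> real \<Rightarrow> real ^ 'N \<Rightarrow> real ^ 'N \<Rightarrow> ereal" where
  "prox_model blk f \<Psi> i \<theta> x s =
     ereal (partial_gradient blk i f x \<bullet> s + \<theta> / 2 * (norm s)\<^sup>2) + \<Psi> i (block blk i x + s)"

text \<open>
  Everything the method computes is determined by the block indices drawn so far.  Hence the
  iterates form a function \<open>x\<close> on finite index histories: after the history
  \<open>w = [i\<^sub>0, \<dots>, i\<^sub>k\<^sub>-\<^sub>1]\<close> the current point is \<open>x w\<close>, the earlier iterates of the same run are
  \<open>x (take i w)\<close> for \<open>i \<le> k\<close>, and if \<open>i\<^sub>k\<close> is drawn next, the step is \<open>d (w @ [i\<^sub>k])\<close>.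
  Natural-number subtraction implements the positive part in the lower end of the window.
\<close>

definition history :: "(nat \<Rightarrow> 'n) \<Rightarrow> nat \<Rightarrow> 'n list" where
  "history \<xi> k = map \<xi> [0..<k]"

definition acceptable ::
  "(real ^ 'N::finite \<Rightarrow> ereal) \<Rightarrow> real \<Rightarrow> nat \<Rightarrow> ('n list \<Rightarrow> real ^ 'N) \<Rightarrow> 'n list \<Rightarrow> real ^ 'N \<Rightarrow> bool"
  where
  "acceptable F \<sigma> M x w s \<longleftrightarrow>
     F (x w + s) \<le> Max ((\<lambda>i. F (x (take i w))) ` {length w - M..length w})
                     - ereal (\<sigma> / 2 * (norm s)\<^sup>2)"

text \<open>
  The inner loop with trial steps \<open>s 0, s 1, \<dots>\<close>: a trial step is computed as long as all earlier
  ones have been rejected, and the loop returns the first acceptable one.  Termination is not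
  built into this definition.
\<close>

definition inner_loop ::
  "('N::finite \<Rightarrow> 'n::finite) \<Rightarrow> (real ^ 'N \<Rightarrow> real) \<Rightarrow> ('n \<Rightarrow> real ^ 'N \<Rightarrow> ereal) \<Rightarrow>
   real \<Rightarrow> real \<Rightarrow> nat \<Rightarrow> ('n list \<Rightarrow> real ^ 'N) \<Rightarrow> 'n list \<Rightarrow> 'n \<Rightarrow> real \<Rightarrow>
   (nat \<Rightarrow> real ^ 'N) \<Rightarrow> real ^ 'N \<Rightarrow> bool" where
  "inner_loop blk f \<Psi> \<eta> \<sigma> M x w i \<theta>0 s r \<longleftrightarrow>
     (\<forall>j. (\<forall>j'<j. \<not> acceptable (objective blk f \<Psi>) \<sigma> M x w (s j')) \<longrightarrow>
        is_arg_min (prox_model blk f \<Psi> i (\<theta>0 * \<eta> ^ j) (x w)) (\<lambda>h. h \<in> block_space blk i) (s j) \<and>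
        (acceptable (objective blk f \<Psi>) \<sigma> M x w (s j) \<longrightarrow> r = s j))"

definition rnbpg ::
  "('N::finite \<Rightarrow> 'n::finite) \<Rightarrow> (real ^ 'N \<Rightarrow> real) \<Rightarrow> ('n \<Rightarrow> real ^ 'N \<Rightarrow> ereal) \<Rightarrow>
   real \<Rightarrow> real \<Rightarrow> real \<Rightarrow> real \<Rightarrow> nat \<Rightarrow> real ^ 'N \<Rightarrow>
   ('n list \<Rightarrow> real ^ 'N) \<Rightarrow> ('n list \<Rightarrow> real ^ 'N) \<Rightarrow> bool" where
  "rnbpg blk f \<Psi> \<eta> \<sigma> \<theta>lo \<theta>hi M x0 x d \<longleftrightarrow>
     x [] = x0 \<and>
     (\<forall>w i. (\<exists>\<theta>0 s. \<theta>0 \<in> {\<theta>lo..\<theta>hi} \<and>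
                inner_loop blk f \<Psi> \<eta> \<sigma> M x w i \<theta>0 s (d (w @ [i]))) \<and>
            x (w @ [i]) = x w + d (w @ [i]))"

end

theory Submission
  imports Defs
begin

text \<open>
  The argument is pathwise, and probability enters only at the very end.

  Along one block the smooth part \<open>f\<close> lies below its quadratic model with curvature \<open>L i\<close>
  (\<open>descent_lemma\<close>). A minimizer of the proximal model with curvature \<open>\<theta> \<ge> L i + \<sigma>\<close> does at least
  as well as the zero step, so it decreases the objective by \<open>\<sigma> / 2 * (norm s)\<^sup>2\<close>
  (\<open>prox_step_decrease\<close>). As \<open>\<theta>\<close> grows geometrically, the inner loop stops, and every step taken
  passes the acceptance test (\<open>step_acceptable\<close>). In particular no run leaves the initial
  sublevel set, on which the objective is finite and bounded.

  What remains is a statement about a single sequence of points (\<open>nonmonotone_descent\<close>). The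
  windowed maximum \<open>V k\<close> of the objective values is nonincreasing and bounded below, so it
  converges to some \<open>v\<close>. If the values along some subsequence tend to \<open>v\<close>, then the
  acceptance test squeezes the preceding steps to \<open>0\<close>, and uniform continuity carries the limit
  \<open>v\<close> over to the preceding points. Starting from the indices where the windowed maximum is attained
  and stepping back at most \<open>M\<close> times, one reaches every index, so the whole sequence of values
  converges to \<open>v\<close>; the acceptance test then forces all steps to \<open>0\<close>.

  The objective values and the steps are uniformly bounded, and at each time they depend on finitely
  many draws from a finite set, so that they are measurable without further ado; the limit of the
  values inherits this. The statements about expectations follow by dominated convergence.
\<close>

section \<open>Blocks and the gradient\<close>

lemma block_in_space: "block blk i y \<in> block_space blk i"
  by (simp add: block_def block_space_def)

lemma zero_in_space: "0 \<in> block_space blk i"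
  by (simp add: block_space_def)

lemma scaleR_in_space: "h \<in> block_space blk i \<Longrightarrow> t *\<^sub>R h \<in> block_space blk i"
  by (simp add: block_space_def)

lemma block_add_same:
  "h \<in> block_space blk i \<Longrightarrow> block blk i (y + h) = block blk i y + h"
  by (auto simp: block_def block_space_def vec_eq_iff)

lemma block_add_other:
  "h \<in> block_space blk i \<Longrightarrow> j \<noteq> i \<Longrightarrow> block blk j (y + h) = block blk j y"
  by (auto simp: block_def block_space_def vec_eq_iff)

lemma inner_block:
  "h \<in> block_space blk i \<Longrightarrow> block blk i g \<bullet> h = g \<bullet> h"
  by (auto simp: block_def block_space_def inner_vec_def intro!: sum.cong)

lemma gradient_derivative:
  fixes f :: "real ^ 'N::finite \<Rightarrow> real"
  assumes "f differentiable (at y)"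
  shows "(f has_derivative (\<lambda>h. gradient f y \<bullet> h)) (at y)"
proof -
  obtain D where D: "(f has_derivative D) (at y)"
    using assms by (auto simp: differentiable_def)
  have "D h = h \<bullet> adjoint D 1" for h
    using adjoint_works[OF has_derivative_linear[OF D], of h 1] by simp
  then have "D = (\<lambda>h. h \<bullet> adjoint D 1)"
    by blast
  then have ex: "GDERIV f y :> adjoint D 1"
    unfolding gderiv_def using D by metis
  have uniq: "g = adjoint D 1" if "GDERIV f y :> g" for g
  proof -
    have "(\<lambda>h. h \<bullet> g) = (\<lambda>h. h \<bullet> adjoint D 1)"
      using that ex has_derivative_unique unfolding gderiv_def by blast
    then have "h \<bullet> g = h \<bullet> adjoint D 1" for h
      by metis
    then show ?thesis
      using vector_eq_ldot by blast
  qed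
  have "GDERIV f y :> gradient f y"
    unfolding gradient_def by (rule theI[of "\<lambda>g. GDERIV f y :> g", OF ex uniq])
  then show ?thesis
    unfolding gderiv_def by (simp add: inner_commute)
qed

section \<open>Decrease along one block\<close>

text \<open>
  The gap between \<open>f\<close> and its quadratic model is nonincreasing along the ray in direction \<open>h\<close>,
  because there the derivative of \<open>f\<close> varies by at most \<open>K * t * (norm h)\<^sup>2\<close>.
\<close>
lemma descent_lemma:
  fixes f :: "real ^ 'N::finite \<Rightarrow> real"
  assumes diff: "\<forall>y. f differentiable (at y)"
    and lip: "\<forall>h\<in>block_space blk i.
      norm (partial_gradient blk i f (y + h) - partial_gradient blk i f y) \<le> K * norm h"
    and h: "h \<in> block_space blk i"
  shows "f (y + h) \<le> f y + partial_gradient blk i f y \<bullet> h + K / 2 * (norm h)\<^sup>2"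
proof -
  define g where
    "g t = f (y + t *\<^sub>R h) - t * (gradient f y \<bullet> h) - K / 2 * t\<^sup>2 * (norm h)\<^sup>2" for t
  have "g 1 \<le> g 0"
  proof (rule DERIV_nonpos_imp_nonincreasing[of 0 1 g])
    fix t :: real assume t: "0 \<le> t" "t \<le> 1"
    have der: "((\<lambda>t. f (y + t *\<^sub>R h)) has_real_derivative gradient f (y + t *\<^sub>R h) \<bullet> h) (at t)"
    proof -
      have "((\<lambda>t. y + t *\<^sub>R h) has_derivative (\<lambda>t. t *\<^sub>R h)) (at t)"
        by (auto intro!: derivative_eq_intros)
      from has_derivative_compose[OF this gradient_derivative[OF diff[rule_format]]]
      show ?thesis
        by (simp add: has_field_derivative_def mult.commute[of _ "gradient f (y + t *\<^sub>R h) \<bullet> h"])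
    qed
    have "(g has_real_derivative
        gradient f (y + t *\<^sub>R h) \<bullet> h - gradient f y \<bullet> h - K * t * (norm h)\<^sup>2) (at t)"
      unfolding g_def by (auto intro!: derivative_eq_intros der)
    moreover have "gradient f (y + t *\<^sub>R h) \<bullet> h - gradient f y \<bullet> h \<le> K * t * (norm h)\<^sup>2"
    proof -
      have "gradient f (y + t *\<^sub>R h) \<bullet> h - gradient f y \<bullet> h
          = (partial_gradient blk i f (y + t *\<^sub>R h) - partial_gradient blk i f y) \<bullet> h"
        by (simp add: partial_gradient_def inner_block[OF h] inner_diff_left)
      also have "\<dots> \<le> norm (partial_gradient blk i f (y + t *\<^sub>R h) - partial_gradient blk i f y)
          * norm h"
        by (rule norm_cauchy_schwarz)
      also have "\<dots> \<le> K * norm (t *\<^sub>R h) * norm h"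
        using lip[rule_format, OF scaleR_in_space[OF h]] by (rule mult_right_mono) simp
      finally show ?thesis
        using t by (simp add: power2_eq_square mult.assoc)
    qed
    ultimately show "\<exists>D. (g has_real_derivative D) (at t) \<and> D \<le> 0"
      by force
  qed simp
  then show ?thesis
    by (simp add: g_def partial_gradient_def inner_block[OF h])
qed

lemma sum_not_MInf:
  fixes g :: "'a \<Rightarrow> ereal"
  assumes "\<And>i. i \<in> A \<Longrightarrow> g i \<noteq> -\<infinity>"
  shows "sum g A \<noteq> -\<infinity>"
  using assms by (induction A rule: infinite_finite_induct) (auto simp: ereal_plus_eq_MInfty)

lemma objective_not_MInf:
  assumes "\<forall>i. \<forall>y\<in>block_space blk i. \<Psi> i y \<noteq> -\<infinity>"
  shows "objective blk f \<Psi> y \<noteq> -\<infinity>"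
proof -
  have "(\<Sum>i\<in>UNIV. \<Psi> i (block blk i y)) \<noteq> -\<infinity>"
    using assms block_in_space[of blk _ y] by (intro sum_not_MInf) auto
  then show ?thesis
    unfolding objective_def by (cases "\<Sum>i\<in>UNIV. \<Psi> i (block blk i y)") auto
qed

text \<open>
  The blocks other than \<open>i\<close> contribute the same finite amount before and after the step. On block
  \<open>i\<close> the comparison with the zero step bounds the change of \<open>\<Psi> i\<close>, and the descent lemma bounds
  the change of \<open>f\<close>; the surplus curvature \<open>\<theta> - K \<ge> \<sigma>\<close> is what remains.
\<close>
lemma prox_step_decrease:
  fixes f :: "real ^ 'N::finite \<Rightarrow> real" and blk :: "'N \<Rightarrow> 'n::finite"
  assumes diff: "\<forall>y. f differentiable (at y)"
    and ninf: "\<forall>i. \<forall>y\<in>block_space blk i. \<Psi> i y \<noteq> -\<infinity>"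
    and lip: "\<forall>h\<in>block_space blk i.
      norm (partial_gradient blk i f (y + h) - partial_gradient blk i f y) \<le> K * norm h"
    and fin: "objective blk f \<Psi> y < \<infinity>"
    and min: "is_arg_min (prox_model blk f \<Psi> i \<theta> y) (\<lambda>h. h \<in> block_space blk i) s"
    and \<theta>: "K + \<sigma> \<le> \<theta>"
  shows "objective blk f \<Psi> (y + s) \<le> objective blk f \<Psi> y - ereal (\<sigma> / 2 * (norm s)\<^sup>2)"
proof -
  have s: "s \<in> block_space blk i"
    using min by (simp add: is_arg_min_def)
  define R where "R = (\<Sum>j\<in>UNIV - {i}. \<Psi> j (block blk j y))"
  have obj_y: "objective blk f \<Psi> y = ereal (f y) + (\<Psi> i (block blk i y) + R)"
    unfolding objective_def R_def by (subst sum.remove[of _ i]) auto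
  have "(\<Sum>j\<in>UNIV - {i}. \<Psi> j (block blk j (y + s))) = R"
    unfolding R_def by (intro sum.cong) (auto simp: block_add_other[OF s])
  then have obj_s:
    "objective blk f \<Psi> (y + s) = ereal (f (y + s)) + (\<Psi> i (block blk i y + s) + R)"
    unfolding objective_def by (subst sum.remove[of _ i]) (auto simp: block_add_same[OF s])
  have R_ninf: "R \<noteq> -\<infinity>"
    unfolding R_def using ninf block_in_space[of blk _ y] by (intro sum_not_MInf) auto
  have a_ninf: "\<Psi> i (block blk i y) \<noteq> -\<infinity>"
    using ninf block_in_space[of blk i y] by simp
  have b_ninf: "\<Psi> i (block blk i y + s) \<noteq> -\<infinity>"
    using ninf block_in_space[of blk i "y + s"] by (simp add: block_add_same[OF s])
  obtain a r where a: "\<Psi> i (block blk i y) = ereal a" and r: "R = ereal r"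
    using fin R_ninf a_ninf unfolding obj_y
    by (cases R; cases "\<Psi> i (block blk i y)") auto
  have "prox_model blk f \<Psi> i \<theta> y s \<le> prox_model blk f \<Psi> i \<theta> y 0"
    using min zero_in_space unfolding is_arg_min_def by (metis not_less)
  then have model: "ereal (partial_gradient blk i f y \<bullet> s + \<theta> / 2 * (norm s)\<^sup>2)
      + \<Psi> i (block blk i y + s) \<le> ereal a"
    by (simp add: prox_model_def a)
  obtain b where b: "\<Psi> i (block blk i y + s) = ereal b"
    using model b_ninf by (cases "\<Psi> i (block blk i y + s)") auto
  have "partial_gradient blk i f y \<bullet> s + \<theta> / 2 * (norm s)\<^sup>2 + b \<le> a"
    using model by (simp add: b)
  moreover have "f (y + s) \<le> f y + partial_gradient blk i f y \<bullet> s + K / 2 * (norm s)\<^sup>2"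
    by (rule descent_lemma[OF diff lip s])
  moreover have "(K + \<sigma>) / 2 * (norm s)\<^sup>2 \<le> \<theta> / 2 * (norm s)\<^sup>2"
    using \<theta> by (intro mult_right_mono) auto
  ultimately have "f (y + s) + b + r \<le> f y + a + r - \<sigma> / 2 * (norm s)\<^sup>2"
    by (simp add: add_divide_distrib distrib_right)
  then show ?thesis
    by (simp add: obj_y obj_s a b r)
qed

section \<open>Termination of the inner loop\<close>

text \<open>
  If every trial step were rejected, the curvature would eventually exceed \<open>K + \<sigma>\<close>. That trial step
  decreases the objective enough relative to the current point, which is itself in the window,
  so it could not have been rejected.
\<close>
lemma step_acceptable:
  fixes f :: "real ^ 'N::finite \<Rightarrow> real" and blk :: "'N \<Rightarrow> 'n::finite"
  assumes diff: "\<forall>y. f differentiable (at y)"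
    and ninf: "\<forall>i. \<forall>y\<in>block_space blk i. \<Psi> i y \<noteq> -\<infinity>"
    and lip: "\<forall>y. \<forall>h\<in>block_space blk i.
      norm (partial_gradient blk i f (y + h) - partial_gradient blk i f y) \<le> K * norm h"
    and fin: "objective blk f \<Psi> (x w) < \<infinity>"
    and \<eta>: "\<eta> > 1" and \<theta>: "\<theta> > 0"
    and loop: "inner_loop blk f \<Psi> \<eta> \<sigma> M x w i \<theta> s r"
  shows "acceptable (objective blk f \<Psi>) \<sigma> M x w r"
proof -
  let ?A = "\<lambda>j. acceptable (objective blk f \<Psi>) \<sigma> M x w (s j)"
  obtain J where "(K + \<sigma>) / \<theta> < \<eta> ^ J"
    using real_arch_pow[OF \<eta>] by blast
  then have J: "K + \<sigma> \<le> \<theta> * \<eta> ^ J"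
    using \<theta> by (simp add: pos_divide_less_eq mult.commute)
  have "\<exists>j. ?A j"
  proof (rule ccontr)
    assume none: "\<not> (\<exists>j. ?A j)"
    then have "is_arg_min (prox_model blk f \<Psi> i (\<theta> * \<eta> ^ J) (x w))
        (\<lambda>h. h \<in> block_space blk i) (s J)"
      using loop unfolding inner_loop_def by blast
    from prox_step_decrease[OF diff ninf lip[rule_format, THEN ballI] fin this J]
    have "objective blk f \<Psi> (x w + s J)
        \<le> objective blk f \<Psi> (x w) - ereal (\<sigma> / 2 * (norm (s J))\<^sup>2)"
      by simp
    also have "objective blk f \<Psi> (x w)
        \<le> Max ((\<lambda>i. objective blk f \<Psi> (x (take i w))) ` {length w - M..length w})"
      by (intro Max_ge) (auto intro!: image_eqI[of _ _ "length w"])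
    finally have "?A J"
      unfolding acceptable_def by (simp add: ereal_minus_mono)
    with none show False
      by blast
  qed
  then obtain j where "?A j" and "\<forall>j'<j. \<not> ?A j'"
    using exists_least_iff[of ?A] by blast
  moreover from this have "r = s j"
    using loop unfolding inner_loop_def by blast
  ultimately show ?thesis
    by simp
qed

section \<open>Nonmonotone descent along a single sequence\<close>

text \<open>
  \<open>V k\<close> is attained at some index in the window ending at \<open>k\<close>. The window of length \<open>M + 1\<close> ending
  at \<open>k + M\<close> starts at \<open>k\<close>, so \<open>k\<close> is at most \<open>M\<close> steps before the index at which \<open>V (k + M)\<close> is attained.
\<close>
lemma nonmonotone_descent:
  fixes u :: "nat \<Rightarrow> 'a::metric_space" and g :: "'a \<Rightarrow> real" and M :: nat
  defines "V \<equiv> \<lambda>k. Max ((\<lambda>i. g (u i)) ` {k - M..k})"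
  assumes uc: "uniformly_continuous_on S g"
    and u: "\<And>k. u k \<in> S"
    and c: "c > 0"
    and dec: "\<And>k. g (u (Suc k)) \<le> V k - c * (dist (u (Suc k)) (u k))\<^sup>2"
    and lower: "\<And>k. m \<le> g (u k)"
  obtains v where "(\<lambda>k. g (u k)) \<longlonglongrightarrow> v" "V \<longlonglongrightarrow> v"
    "(\<lambda>k. dist (u (Suc k)) (u k)) \<longlonglongrightarrow> 0"
proof -
  have V_ge: "g (u i) \<le> V k" if "k - M \<le> i" "i \<le> k" for i k
    unfolding V_def using that by (intro Max_ge) auto
  have dec': "g (u (Suc k)) \<le> V k" for k
    using dec[of k] c by (smt (verit) zero_le_mult_iff zero_le_power2)
  have "decseq V"
  proof (rule decseq_SucI)
    fix k
    have "g (u i) \<le> V k" if "i \<in> {Suc k - M..Suc k}" for i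
      using that V_ge[of k i] dec'[of k] by (cases "i = Suc k") auto
    then show "V (Suc k) \<le> V k"
      by (subst (1) V_def, subst Max_le_iff) auto
  qed
  moreover have "\<forall>k. m \<le> V k"
    using lower V_ge order_trans by (metis diff_le_self order_refl)
  ultimately obtain v where V: "V \<longlonglongrightarrow> v"
    using decseq_convergent by blast

  \<comment> \<open>If the values right after the indices \<open>n k\<close> tend to \<open>v\<close>, both sides of the acceptance test at
    \<open>n k\<close> have the same limit, which leaves no room for the squared step.\<close>
  have step: "(\<lambda>k. dist (u (Suc (n k))) (u (n k))) \<longlonglongrightarrow> 0"
    if n: "filterlim n at_top sequentially" and lim: "(\<lambda>k. g (u (Suc (n k)))) \<longlonglongrightarrow> v"
    for n :: "nat \<Rightarrow> nat"
  proof -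
    have "(\<lambda>k. (V (n k) - g (u (Suc (n k)))) / c) \<longlonglongrightarrow> (v - v) / c"
      by (intro tendsto_intros lim filterlim_compose[OF V n]) (use c in simp)
    then have room: "(\<lambda>k. (V (n k) - g (u (Suc (n k)))) / c) \<longlonglongrightarrow> 0"
      by simp
    have "(dist (u (Suc (n k))) (u (n k)))\<^sup>2 \<le> (V (n k) - g (u (Suc (n k)))) / c" for k
      using dec[of "n k"] c by (simp add: pos_le_divide_eq mult.commute)
    then have "(\<lambda>k. (dist (u (Suc (n k))) (u (n k)))\<^sup>2) \<longlonglongrightarrow> 0"
      by (intro Lim_null_comparison[OF _ room]) simp
    from tendsto_real_sqrt[OF this] show ?thesis
      by simp
  qed
  have preceding: "(\<lambda>k. g (u (n k))) \<longlonglongrightarrow> v"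
    if n: "filterlim n at_top sequentially" and lim: "(\<lambda>k. g (u (Suc (n k)))) \<longlonglongrightarrow> v"
    for n :: "nat \<Rightarrow> nat"
  proof -
    have "(\<lambda>k. dist (g (u (Suc (n k)))) (g (u (n k)))) \<longlonglongrightarrow> 0"
      using uc[unfolded uniformly_continuous_on_sequentially, rule_format,
          of "\<lambda>k. u (Suc (n k))" "\<lambda>k. u (n k)"] step[OF n lim] u by simp
    then have "(\<lambda>k. g (u (Suc (n k))) - g (u (n k))) \<longlonglongrightarrow> 0"
      by (simp add: dist_norm tendsto_norm_zero_iff tendsto_rabs_zero_iff)
    from tendsto_diff[OF lim this] show ?thesis
      by simp
  qed

  have "\<exists>i\<in>{k - M..k}. V k = g (u i)" for k
  proof -
    have "V k \<in> (\<lambda>i. g (u i)) ` {k - M..k}"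
      unfolding V_def by (rule Max_in) auto
    then show ?thesis
      by blast
  qed
  then obtain a where a: "a k \<in> {k - M..k}" "V k = g (u (a k))" for k
    by metis
  define b where "b k = a (k + M)" for k
  have b: "k \<le> b k" "b k \<le> k + M" for k
    using a(1)[of "k + M"] by (auto simp: b_def)
  have b_lim: "filterlim (\<lambda>k. b k - j) at_top sequentially" for j
  proof (rule filterlim_at_top_mono[OF filterlim_minus_const_nat_at_top[of j]])
    show "\<forall>\<^sub>F k in sequentially. k - j \<le> b k - j"
      using b(1) by (intro always_eventually) (auto intro: diff_le_mono)
  qed
  have preceding_j: "(\<lambda>k. g (u (b k - j))) \<longlonglongrightarrow> v" for j
  proof (induction j)
    case 0
    have "(\<lambda>k. V (k + M)) \<longlonglongrightarrow> v"
      using V by (rule LIMSEQ_ignore_initial_segment)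
    then show ?case
      using a(2) by (simp add: b_def)
  next
    case (Suc j)
    show ?case
    proof (rule preceding[OF b_lim])
      have "\<forall>\<^sub>F k in sequentially. g (u (b k - j)) = g (u (Suc (b k - Suc j)))"
        using eventually_gt_at_top[of j]
      proof eventually_elim
        case (elim k)
        then have "b k - j = Suc (b k - Suc j)"
          using b(1)[of k] by linarith
        then show ?case
          by simp
      qed
      then show "(\<lambda>k. g (u (Suc (b k - Suc j)))) \<longlonglongrightarrow> v"
        using Suc.IH by (rule Lim_transform_eventually[rotated])
    qed
  qed
  have lim: "(\<lambda>k. g (u k)) \<longlonglongrightarrow> v"
  proof (rule tendstoI)
    fix e :: real assume "e > 0"
    then have "\<forall>\<^sub>F k in sequentially. \<forall>j\<in>{..M}. dist (g (u (b k - j))) v < e"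
      using preceding_j by (intro eventually_ball_finite) (auto dest: tendstoD)
    then show "\<forall>\<^sub>F k in sequentially. dist (g (u k)) v < e"
    proof eventually_elim
      case (elim k)
      have "b k - (b k - k) = k" "b k - k \<in> {..M}"
        using b[of k] by auto
      with elim show ?case
        by metis
    qed
  qed
  from lim V step[OF filterlim_ident] show thesis
    using LIMSEQ_Suc[OF lim] by (intro that) auto
qed

section \<open>Random histories\<close>

lemma length_history: "length (history \<xi> k) = k"
  by (simp add: history_def)

lemma take_history: "i \<le> k \<Longrightarrow> take i (history \<xi> k) = history \<xi> i"
  by (simp add: history_def take_map)

lemma history_Suc: "history \<xi> (Suc k) = history \<xi> k @ [\<xi> k]"
  by (simp add: history_def)

text \<open>
  There are only countably many histories, so measurability of the draws makes every function
  of a history measurable.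
\<close>
lemma measurable_history_function:
  fixes I :: "nat \<Rightarrow> 'w \<Rightarrow> 'n::finite" and g :: "'n list \<Rightarrow> 'b"
  assumes I: "\<And>k. I k \<in> measurable P (count_space UNIV)" and g: "\<And>w. g w \<in> space N"
  shows "(\<lambda>\<omega>. g (history (\<lambda>j. I j \<omega>) k)) \<in> measurable P N"
proof -
  have "(\<lambda>\<omega>. history (\<lambda>j. I j \<omega>) k) \<in> measurable P (count_space UNIV)"
  proof (induction k)
    case 0
    show ?case
      by (simp add: history_def)
  next
    case (Suc k)
    have "(\<lambda>\<omega>. (\<lambda>w. w @ [I k \<omega>]) (history (\<lambda>j. I j \<omega>) k)) \<in> measurable P (count_space UNIV)"
    proof (rule measurable_compose_countable[OF _ Suc.IH])
      show "(\<lambda>\<omega>. w @ [I k \<omega>]) \<in> measurable P (count_space UNIV)" for w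
        by (rule measurable_compose[OF I]) simp
    qed
    then show ?case
      by (simp add: history_Suc)
  qed
  then show ?thesis
    by (rule measurable_compose) (use g in \<open>auto simp: measurable_count_space_eq1\<close>)
qed

theorem theorem2p6:
  fixes blk :: "'N::finite \<Rightarrow> 'n::finite"
    and f :: "real ^ 'N \<Rightarrow> real"
    and \<Psi> :: "'n \<Rightarrow> real ^ 'N \<Rightarrow> ereal"
    and F :: "real ^ 'N \<Rightarrow> ereal"
    and L p :: "'n \<Rightarrow> real"
    and \<eta> \<sigma> \<theta>lo \<theta>hi :: real
    and M :: nat
    and x0 :: "real ^ 'N"
    and x d :: "'n list \<Rightarrow> real ^ 'N"
    and l :: "'n list \<Rightarrow> nat"
    and P :: "'w measure"
    and I :: "nat \<Rightarrow> 'w \<Rightarrow> 'n"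
  defines "F \<equiv> objective blk f \<Psi>"
  assumes "surj blk"
    and "\<forall>y. f differentiable (at y)"
    and "\<forall>i. \<forall>y\<in>block_space blk i. \<Psi> i y \<noteq> -\<infinity>"
    and "\<forall>i. L i > 0"
    and "\<forall>y i. \<forall>h\<in>block_space blk i.
           norm (partial_gradient blk i f (y + h) - partial_gradient blk i f y) \<le> L i * norm h"
    and "\<exists>y. \<forall>z. F y \<le> F z"
    and "F x0 < \<infinity>"
    and "\<eta> > 1" and "\<sigma> > 0" and "0 < \<theta>lo" and "\<theta>lo \<le> \<theta>hi"
    and "\<forall>i. 0 < p i \<and> p i < 1" and "(\<Sum>i\<in>UNIV. p i) = 1"
    and "rnbpg blk f \<Psi> \<eta> \<sigma> \<theta>lo \<theta>hi M x0 x d"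
    and "\<forall>w. is_arg_max (\<lambda>i. F (x (take i w))) (\<lambda>i. i \<in> {length w - M..length w}) (l w)"
    and "prob_space P"
    and "prob_space.indep_vars P (\<lambda>_. count_space UNIV) I UNIV"
    and "\<forall>k i. measure P {\<omega> \<in> space P. I k \<omega> = i} = p i"
    and "uniformly_continuous_on {y. F y \<le> F x0} (\<lambda>y. real_of_ereal (F y))"
  shows "\<exists>Fstar :: (nat \<Rightarrow> 'n) \<Rightarrow> real.
    (\<forall>\<xi>. (\<lambda>k. norm (d (history \<xi> (Suc k)))) \<longlonglongrightarrow> 0 \<and>
         (\<forall>k. F (x (history \<xi> k)) < \<infinity>) \<and>
         (\<lambda>k. F (x (history \<xi> k))) \<longlonglongrightarrow> ereal (Fstar \<xi>)) \<and>
    (\<lambda>k. \<integral>\<omega>. norm (d (history (\<lambda>j. I j \<omega>) (Suc k))) \<partial>P) \<longlonglongrightarrow> 0 \<and>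
    integrable P (\<lambda>\<omega>. Fstar (\<lambda>j. I j \<omega>)) \<and>
    (\<lambda>k. \<integral>\<omega>. real_of_ereal (F (x (history (\<lambda>j. I j \<omega>) k))) \<partial>P)
       \<longlonglongrightarrow> (\<integral>\<omega>. Fstar (\<lambda>j. I j \<omega>) \<partial>P) \<and>
    (\<lambda>k. \<integral>\<omega>. real_of_ereal (F (x (history (\<lambda>j. I j \<omega>) (l (history (\<lambda>j. I j \<omega>) k))))) \<partial>P)
       \<longlonglongrightarrow> (\<integral>\<omega>. Fstar (\<lambda>j. I j \<omega>) \<partial>P)"
proof -
  note diff = \<open>\<forall>y. f differentiable (at y)\<close>
    and ninf = \<open>\<forall>i. \<forall>y\<in>block_space blk i. \<Psi> i y \<noteq> -\<infinity>\<close>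
    and \<sigma> = \<open>\<sigma> > 0\<close>
  have lip: "\<forall>y. \<forall>h\<in>block_space blk i.
      norm (partial_gradient blk i f (y + h) - partial_gradient blk i f y) \<le> L i * norm h" for i
    using \<open>\<forall>y i. \<forall>h\<in>block_space blk i. _ \<le> L i * norm h\<close> by blast
  have x_Nil: "x [] = x0" and x_snoc: "x (w @ [i]) = x w + d (w @ [i])" for w i
    using \<open>rnbpg blk f \<Psi> \<eta> \<sigma> \<theta>lo \<theta>hi M x0 x d\<close> by (auto simp: rnbpg_def)
  have F_ninf: "F y \<noteq> -\<infinity>" for y
    unfolding F_def by (rule objective_not_MInf[OF ninf])

  have accept: "F (x (w @ [i])) \<le> Max ((\<lambda>j. F (x (take j w))) ` {length w - M..length w})
      - ereal (\<sigma> / 2 * (norm (d (w @ [i])))\<^sup>2)" if "F (x w) < \<infinity>" for w i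
  proof -
    obtain \<theta> s where \<theta>: "\<theta> \<in> {\<theta>lo..\<theta>hi}"
      and loop: "inner_loop blk f \<Psi> \<eta> \<sigma> M x w i \<theta> s (d (w @ [i]))"
      using \<open>rnbpg blk f \<Psi> \<eta> \<sigma> \<theta>lo \<theta>hi M x0 x d\<close> unfolding rnbpg_def by blast
    have "acceptable F \<sigma> M x w (d (w @ [i]))"
      using that \<theta> \<open>0 < \<theta>lo\<close> unfolding F_def
      by (intro step_acceptable[OF diff ninf lip _ \<open>\<eta> > 1\<close> _ loop]) auto
    then show ?thesis
      by (simp add: acceptable_def x_snoc)
  qed

  \<comment> \<open>The bound is proved for all prefixes at once, since the acceptance test refers to the whole
    window of earlier points.\<close>
  have "\<forall>j. F (x (take j w)) \<le> F x0" for w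
  proof (induction w rule: rev_induct)
    case Nil
    show ?case
      by (simp add: x_Nil)
  next
    case (snoc i w)
    have "F (x w) \<le> F x0"
      using snoc.IH[rule_format, of "length w"] by simp
    then have "F (x (w @ [i])) \<le> Max ((\<lambda>j. F (x (take j w))) ` {length w - M..length w})
        - ereal (\<sigma> / 2 * (norm (d (w @ [i])))\<^sup>2)"
      using \<open>F x0 < \<infinity>\<close> by (intro accept) auto
    also have "\<dots> \<le> F x0 - 0"
      using snoc.IH \<sigma> by (intro ereal_minus_mono) auto
    finally show ?case
      using snoc.IH by (auto simp: take_Cons' not_le)
  qed
  then have sublevel: "F (x w) \<le> F x0" for w
    by (metis take_all order_refl)

  define G where "G y = real_of_ereal (F y)" for y
  have G: "F y = ereal (G y)" if "F y \<le> F x0" for y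
    using that \<open>F x0 < \<infinity>\<close> F_ninf[of y] unfolding G_def by (cases "F y") auto
  obtain y0 where y0: "\<forall>z. F y0 \<le> F z"
    using \<open>\<exists>y. \<forall>z. F y \<le> F z\<close> by blast
  have G_lower: "G y0 \<le> G (x w)" and G_upper: "G (x w) \<le> G x0" for w
    using y0[rule_format, of "x w"] G[OF y0[rule_format, of x0]] G[OF sublevel[of w]] G[of x0]
      sublevel[of w] by auto

  define V where "V \<xi> k = Max ((\<lambda>i. G (x (history \<xi> i))) ` {k - M..k})" for \<xi> k
  have max_window: "Max ((\<lambda>i. F (x (take i (history \<xi> k)))) ` {k - M..k}) = ereal (V \<xi> k)" for \<xi> k
  proof -
    have "(\<lambda>i. F (x (take i (history \<xi> k)))) ` {k - M..k}
        = ereal ` (\<lambda>i. G (x (history \<xi> i))) ` {k - M..k}"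
      unfolding image_image by (intro image_cong) (auto simp: take_history G[OF sublevel])
    then show ?thesis
      unfolding V_def by (simp add: mono_Max_commute[of ereal, symmetric] mono_def)
  qed
  have step: "dist (x (history \<xi> (Suc k))) (x (history \<xi> k)) = norm (d (history \<xi> (Suc k)))"
    for \<xi> k
    by (simp add: history_Suc x_snoc dist_norm)
  have dec: "G (x (history \<xi> (Suc k)))
      \<le> V \<xi> k - \<sigma> / 2 * (dist (x (history \<xi> (Suc k))) (x (history \<xi> k)))\<^sup>2" for \<xi> k
  proof -
    have "F (x (history \<xi> k)) < \<infinity>"
      using G[OF sublevel] by simp
    from accept[OF this, of "\<xi> k"]
    have "F (x (history \<xi> (Suc k)))
        \<le> ereal (V \<xi> k) - ereal (\<sigma> / 2 * (norm (d (history \<xi> (Suc k))))\<^sup>2)"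
      unfolding length_history max_window history_Suc .
    then show ?thesis
      by (simp add: step G[OF sublevel])
  qed
  have uc: "uniformly_continuous_on {y. F y \<le> F x0} G"
    using \<open>uniformly_continuous_on {y. F y \<le> F x0} (\<lambda>y. real_of_ereal (F y))\<close>
    by (simp add: G_def[abs_def])

  have "\<exists>v. (\<lambda>k. G (x (history \<xi> k))) \<longlonglongrightarrow> v \<and> V \<xi> \<longlonglongrightarrow> v
      \<and> (\<lambda>k. norm (d (history \<xi> (Suc k)))) \<longlonglongrightarrow> 0" for \<xi>
  proof (rule nonmonotone_descent[where u = "\<lambda>k. x (history \<xi> k)" and M = M, OF uc])
    show "x (history \<xi> k) \<in> {y. F y \<le> F x0}" for k
      using sublevel by simp
    show "\<sigma> / 2 > 0"
      using \<sigma> by simp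
  qed (use dec G_lower in \<open>auto simp: step V_def[abs_def]\<close>)
  then obtain Fstar where Fstar: "(\<lambda>k. G (x (history \<xi> k))) \<longlonglongrightarrow> Fstar \<xi>"
    "V \<xi> \<longlonglongrightarrow> Fstar \<xi>" "(\<lambda>k. norm (d (history \<xi> (Suc k)))) \<longlonglongrightarrow> 0" for \<xi>
    by metis

  have argmax: "G (x (history \<xi> (l (history \<xi> k)))) = V \<xi> k"
    and l_le: "l (history \<xi> k) \<le> k" for \<xi> k
  proof -
    have l: "is_arg_max (\<lambda>i. F (x (take i (history \<xi> k)))) (\<lambda>i. i \<in> {k - M..k}) (l (history \<xi> k))"
      using \<open>\<forall>w. is_arg_max _ _ (l w)\<close>[rule_format, of "history \<xi> k"] by (simp add: length_history)
    then show le: "l (history \<xi> k) \<le> k"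
      by (simp add: is_arg_max_def)
    have "Max ((\<lambda>i. F (x (take i (history \<xi> k)))) ` {k - M..k})
        = F (x (take (l (history \<xi> k)) (history \<xi> k)))"
      using l unfolding is_arg_max_linorder by (intro Max_eqI) auto
    then have "ereal (V \<xi> k) = F (x (history \<xi> (l (history \<xi> k))))"
      unfolding max_window take_history[OF le] .
    then show "G (x (history \<xi> (l (history \<xi> k)))) = V \<xi> k"
      by (simp add: G[OF sublevel])
  qed

  have d_bound: "norm (d (history \<xi> (Suc k))) \<le> sqrt ((G x0 - G y0) / (\<sigma> / 2))" for \<xi> k
  proof (rule real_le_rsqrt)
    have "V \<xi> k \<le> G x0"
      using G_upper unfolding argmax[symmetric] .
    then show "(norm (d (history \<xi> (Suc k))))\<^sup>2 \<le> (G x0 - G y0) / (\<sigma> / 2)"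
      using dec[of \<xi> k] G_lower[of "history \<xi> (Suc k)"] \<sigma>
      by (simp add: step pos_le_divide_eq algebra_simps)
  qed

  interpret prob_space P
    by fact
  have I_meas: "I k \<in> measurable P (count_space UNIV)" for k
    using \<open>indep_vars (\<lambda>_. count_space UNIV) I UNIV\<close> by (auto simp: indep_vars_def)
  have meas: "(\<lambda>\<omega>. g (history (\<lambda>j. I j \<omega>) k)) \<in> borel_measurable P"
    for g :: "'n list \<Rightarrow> real" and k
    by (rule measurable_history_function[OF I_meas]) simp
  have G_bound: "norm (G (x w)) \<le> max \<bar>G y0\<bar> \<bar>G x0\<bar>" for w
    using G_lower[of w] G_upper[of w] by auto
  have Fstar_meas: "(\<lambda>\<omega>. Fstar (\<lambda>j. I j \<omega>)) \<in> borel_measurable P"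
    by (rule borel_measurable_LIMSEQ_real[where u = "\<lambda>k \<omega>. G (x (history (\<lambda>j. I j \<omega>) k))"])
      (use Fstar(1) meas[of "\<lambda>w. G (x w)"] in auto)
  have dominated: "(\<lambda>k. \<integral>\<omega>. g (history (\<lambda>j. I j \<omega>) k) \<partial>P) \<longlonglongrightarrow> (\<integral>\<omega>. h \<omega> \<partial>P) \<and> integrable P h"
    if "h \<in> borel_measurable P" "\<And>w. norm (g w) \<le> B"
      "\<And>\<omega>. (\<lambda>k. g (history (\<lambda>j. I j \<omega>) k)) \<longlonglongrightarrow> h \<omega>"
    for g :: "'n list \<Rightarrow> real" and h B
  proof -
    let ?s = "\<lambda>k \<omega>. g (history (\<lambda>j. I j \<omega>) k)"
    have ae: "AE \<omega> in P. (\<lambda>k. ?s k \<omega>) \<longlonglongrightarrow> h \<omega>" "\<And>k. AE \<omega> in P. norm (?s k \<omega>) \<le> B"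
      using that by simp_all
    note conv = \<open>h \<in> borel_measurable P\<close> meas[of g] integrable_const[of B] ae
    show ?thesis
      using integral_dominated_convergence[of h P ?s "\<lambda>_. B", OF conv]
        integrable_dominated_convergence[of h P ?s "\<lambda>_. B", OF conv] by simp
  qed

  have val_means: "(\<lambda>k. \<integral>\<omega>. G (x (history (\<lambda>j. I j \<omega>) k)) \<partial>P) \<longlonglongrightarrow> (\<integral>\<omega>. Fstar (\<lambda>j. I j \<omega>) \<partial>P)
      \<and> integrable P (\<lambda>\<omega>. Fstar (\<lambda>j. I j \<omega>))"
    using Fstar_meas G_bound Fstar(1) by (intro dominated[of _ "\<lambda>w. G (x w)"])
  \<comment> \<open>Cutting the history back to length \<open>l w\<close> writes \<open>x\<close> at the maximizing index as a function of
    the full history.\<close>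
  have "(\<lambda>k. \<integral>\<omega>. G (x (take (l (history (\<lambda>j. I j \<omega>) k)) (history (\<lambda>j. I j \<omega>) k))) \<partial>P)
      \<longlonglongrightarrow> (\<integral>\<omega>. Fstar (\<lambda>j. I j \<omega>) \<partial>P) \<and> integrable P (\<lambda>\<omega>. Fstar (\<lambda>j. I j \<omega>))"
    using Fstar_meas G_bound Fstar(2)
    by (intro dominated[of _ "\<lambda>w. G (x (take (l w) w))"])
      (simp_all add: take_history[OF l_le] argmax)
  then have max_means: "(\<lambda>k. \<integral>\<omega>. G (x (history (\<lambda>j. I j \<omega>) (l (history (\<lambda>j. I j \<omega>) k)))) \<partial>P)
      \<longlonglongrightarrow> (\<integral>\<omega>. Fstar (\<lambda>j. I j \<omega>) \<partial>P)"
    by (simp add: take_history[OF l_le])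
  have "(\<lambda>k. \<integral>\<omega>. norm (d (history (\<lambda>j. I j \<omega>) (Suc k))) \<partial>P) \<longlonglongrightarrow> (\<integral>\<omega>. 0 \<partial>P)"
    by (rule integral_dominated_convergence[where w = "\<lambda>_. sqrt ((G x0 - G y0) / (\<sigma> / 2))"])
      (use meas[of "\<lambda>w. norm (d w)"] d_bound Fstar(3) in auto)
  then have step_means: "(\<lambda>k. \<integral>\<omega>. norm (d (history (\<lambda>j. I j \<omega>) (Suc k))) \<partial>P) \<longlonglongrightarrow> 0"
    by simp
  have paths: "(\<forall>k. F (x (history \<xi> k)) < \<infinity>)
      \<and> (\<lambda>k. F (x (history \<xi> k))) \<longlonglongrightarrow> ereal (Fstar \<xi>)" for \<xi>
    using Fstar(1)[of \<xi>] by (simp add: G[OF sublevel])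
  show ?thesis
    using Fstar(3) paths step_means val_means max_means unfolding G_def by blast
qed

end
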